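(* Let $U$ be a structured set class with coproduct $\coprod$, let $k$ be a nonnegative integer, and let $F$ be an additive structured set function for $U$ that has regulars. Let $U_{F,k}$ be the class of all $(P,T) \in U$ such that $R_{F,P}(i) = 0$ for all integers $i > k$. Then $U_{F,k}$ is $F$-finitely representable: there is a finite set $Z \subseteq U_{F,k}$ such that every structured set $P \in U_{F,k}$ satisfies $R_{F,P} = R_{F,Q}$ for some structured set $Q$ of the form $Q = P_1 \coprod P_2 \coprod \cdots \coprod P_n$ with $n \ge 1$ and each $P_i \in Z$ (repetitions allowed).
   Context: A structured set class is a class $U$ of ordered pairs $(P,T)$, where $P$ is a finite set (and $T$ is an arbitrary "label"), together with an associative, commutative binary operation $\coprod : U \times U \to U$ called coproduct. Members of $U$ are called structured sets. A structured set function for $U$ is a function $F$ with values in $\mathbb{N} = \{0,1,2,\ldots\}$ whose domain consists of all triples $(P,T,x)$ with $(P,T) \in U$ and $x \in P$. For $(P,T) \in U$, the $F$-regularity sequence of $P$ is the sequence $R_{F,P}$ defined by $R_{F,P}(i) = |\{ v \in P : F(P,T,v) = i\}|$ for each $i \in \mathbb{N}$. $F$ is additive if $R_{F, P \coprod Q} = R_{F,P} + R_{F,Q}$ (termwise sum) for all structured sets $P, Q \in U$. $F$ has regulars if for every nonnegative integer $i$ there is a structured set $P \in U$ such that the support of $R_{F,P}$ (the set of $j$ with $R_{F,P}(j) > 0$) is exactly $\{i\}$. *)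

theory Defs
  imports Main
begin

text \<open>
  A structured set is a pair (P, T) of a finite set and a label. Since HOL has no proper
  classes, a class of structured sets is a set over arbitrary types of points
  and labels; these types are universally quantified in each theorem.
\<close>

type_synonym ('a, 't) structured_set = "'a set \<times> 't"

locale structured_set_class =
  fixes U :: "('a, 't) structured_set set"
    and coprod :: "('a, 't) structured_set \<Rightarrow> ('a, 't) structured_set \<Rightarrow> ('a, 't) structured_set"
  assumes finite_points: "(P, T) \<in> U \<Longrightarrow> finite P"
    and coprod_closed: "X \<in> U \<Longrightarrow> Y \<in> U \<Longrightarrow> coprod X Y \<in> U"
    and coprod_assoc:
      "X \<in> U \<Longrightarrow> Y \<in> U \<Longrightarrow> W \<in> U \<Longrightarrow> coprod (coprod X Y) W = coprod X (coprod Y W)"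
    and coprod_commute: "X \<in> U \<Longrightarrow> Y \<in> U \<Longrightarrow> coprod X Y = coprod Y X"

text \<open>
  A structured set function is a total HOL function on triples (P, T, x). Its values at triples
  with (P, T) outside the class, or x outside P, are never used below: R counts only points of P, and
  every other definition applies R only to members of the class.
\<close>

type_synonym ('a, 't) structured_set_function = "'a set \<times> 't \<times> 'a \<Rightarrow> nat"

definition regularity_sequence ::
    "('a, 't) structured_set_function \<Rightarrow> ('a, 't) structured_set \<Rightarrow> nat \<Rightarrow> nat" where
  "regularity_sequence F X i = card {v \<in> fst X. F (fst X, snd X, v) = i}"

definition additive ::
    "('a, 't) structured_set set
      \<Rightarrow> (('a, 't) structured_set \<Rightarrow> ('a, 't) structured_set \<Rightarrow> ('a, 't) structured_set)
      \<Rightarrow> ('a, 't) structured_set_function \<Rightarrow> bool" where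
  "additive U coprod F \<longleftrightarrow>
    (\<forall>X\<in>U. \<forall>Y\<in>U. regularity_sequence F (coprod X Y) =
      (\<lambda>i. regularity_sequence F X i + regularity_sequence F Y i))"

definition has_regulars ::
    "('a, 't) structured_set set \<Rightarrow> ('a, 't) structured_set_function \<Rightarrow> bool" where
  "has_regulars U F \<longleftrightarrow>
    (\<forall>i. \<exists>X\<in>U. {j. regularity_sequence F X j > 0} = {i})"

definition bounded_subclass ::
    "('a, 't) structured_set set \<Rightarrow> ('a, 't) structured_set_function \<Rightarrow> nat
      \<Rightarrow> ('a, 't) structured_set set" where
  "bounded_subclass U F k = {X \<in> U. \<forall>i>k. regularity_sequence F X i = 0}"

text \<open>The coproduct of a nonempty list, bracketed to the left.\<close>

definition iterated_coproduct ::
    "(('a, 't) structured_set \<Rightarrow> ('a, 't) structured_set \<Rightarrow> ('a, 't) structured_set)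
      \<Rightarrow> ('a, 't) structured_set list \<Rightarrow> ('a, 't) structured_set" where
  "iterated_coproduct coprod Xs = foldl coprod (hd Xs) (tl Xs)"

definition finitely_representable ::
    "(('a, 't) structured_set \<Rightarrow> ('a, 't) structured_set \<Rightarrow> ('a, 't) structured_set)
      \<Rightarrow> ('a, 't) structured_set_function \<Rightarrow> ('a, 't) structured_set set \<Rightarrow> bool" where
  "finitely_representable coprod F V \<longleftrightarrow>
    (\<exists>Z. finite Z \<and> Z \<subseteq> V \<and>
      (\<forall>X\<in>V. \<exists>Xs. Xs \<noteq> [] \<and> set Xs \<subseteq> Z \<and>
        regularity_sequence F X = regularity_sequence F (iterated_coproduct coprod Xs)))"

end

theory Submission
  imports Defs
begin

text \<open>
  Fix regular structured sets \<open>A i\<close> whose regularity sequence is \<open>d i\<close> at \<open>i\<close> and \<open>0\<close>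
  elsewhere, with \<open>d i > 0\<close>. If two members of the bounded class have regularity sequences that
  agree modulo \<open>d i\<close> and satisfy \<open>\<le>\<close> in every coordinate \<open>i \<le> k\<close>, then the larger one is
  represented by the coproduct of the smaller one with copies of the \<open>A i\<close>. A version of
  Dickson's lemma for this order yields finitely many members below all others; these and the
  \<open>A i\<close> form the representing set.
\<close>

text \<open>Induction on the set of coordinates. For a new coordinate \<open>j\<close>, the finite
  sets found for the residue classes modulo \<open>d j\<close> have \<open>j\<close>-values bounded
  by some \<open>N\<close>. Elements with \<open>j\<close>-value above \<open>N\<close> are handled
  by their residue class, the others by one of the finitely many level sets of that
  coordinate.\<close>

lemma Dickson_mod:
  fixes r :: "'b \<Rightarrow> 'i \<Rightarrow> nat" and d :: "'i \<Rightarrow> nat"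
  assumes "finite I" and "\<And>i. i \<in> I \<Longrightarrow> d i > 0"
  shows "\<exists>B. finite B \<and> B \<subseteq> S \<and>
    (\<forall>y\<in>S. \<exists>x\<in>B. \<forall>i\<in>I. r x i \<le> r y i \<and> r x i mod d i = r y i mod d i)"
  using assms
proof (induction I arbitrary: S rule: finite_induct)
  case empty
  show ?case
  proof (cases "S = {}")
    case False
    then obtain x where "x \<in> S" by blast
    then show ?thesis by (intro exI[of _ "{x}"]) auto
  qed auto
next
  case (insert j I)
  have "\<exists>B. finite B \<and> B \<subseteq> S' \<and>
      (\<forall>y\<in>S'. \<exists>x\<in>B. \<forall>i\<in>I. r x i \<le> r y i \<and> r x i mod d i = r y i mod d i)" for S'
    using insert.IH insert.prems by blast
  then obtain B where fin: "\<And>S'. finite (B S')" and sub: "\<And>S'. B S' \<subseteq> S'"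
    and dom: "\<And>S' y. y \<in> S' \<Longrightarrow>
      \<exists>x\<in>B S'. \<forall>i\<in>I. r x i \<le> r y i \<and> r x i mod d i = r y i mod d i"
    by metis
  define C where "C = (\<Union>c<d j. B {y \<in> S. r y j mod d j = c})"
  have finC: "finite C" unfolding C_def using fin by blast
  then have "finite ((\<lambda>x. r x j) ` C)" by blast
  then obtain N where N: "\<And>x. x \<in> C \<Longrightarrow> r x j \<le> N"
    by (meson finite_nat_set_iff_bounded_le imageI)
  \<comment> \<open>Within a level set the \<open>j\<close>-values are equal, so both conditions at
    \<open>j\<close> are automatic.\<close>
  define D where "D = C \<union> (\<Union>n\<le>N. B {y \<in> S. r y j = n})"
  have "finite D" unfolding D_def using finC fin by blast
  moreover have "D \<subseteq> S" unfolding D_def C_def using sub by blast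
  moreover have
    "\<exists>x\<in>D. \<forall>i\<in>insert j I. r x i \<le> r y i \<and> r x i mod d i = r y i mod d i" if "y \<in> S" for y
  proof (cases "r y j \<le> N")
    case True
    obtain x where x: "x \<in> B {z \<in> S. r z j = r y j}"
      and "\<forall>i\<in>I. r x i \<le> r y i \<and> r x i mod d i = r y i mod d i"
      using dom[of y "{z \<in> S. r z j = r y j}"] \<open>y \<in> S\<close> by blast
    moreover have "r x j = r y j" using x sub by blast
    moreover have "x \<in> D" unfolding D_def using x True by blast
    ultimately show ?thesis by (intro bexI[of _ x]) auto
  next
    case False
    let ?S = "{z \<in> S. r z j mod d j = r y j mod d j}"
    obtain x where x: "x \<in> B ?S"
      and "\<forall>i\<in>I. r x i \<le> r y i \<and> r x i mod d i = r y i mod d i"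
      using dom[of y ?S] \<open>y \<in> S\<close> by blast
    moreover have "r x j mod d j = r y j mod d j" using x sub by blast
    \<comment> \<open>Since \<open>d j > 0\<close>, the residue of \<open>r y j\<close> is one of
      those indexing \<open>C\<close>.\<close>
    moreover have "x \<in> C" unfolding C_def using x insert.prems by auto
    moreover from this have "r x j \<le> r y j" using N False by fastforce
    ultimately show ?thesis unfolding D_def by (intro bexI[of _ x]) auto
  qed
  ultimately show ?case by (intro exI[of _ D]) blast
qed

lemma regularity_sequence_foldl:
  assumes "structured_set_class U coprod" and "additive U coprod F"
    and "X \<in> U" and "set Xs \<subseteq> U"
  shows "regularity_sequence F (foldl coprod X Xs) i =
    regularity_sequence F X i + (\<Sum>Y\<leftarrow>Xs. regularity_sequence F Y i)"
  using assms(3,4)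
proof (induction Xs arbitrary: X)
  case (Cons Y Xs)
  \<comment> \<open>Additivity speaks only of members of \<open>U\<close>, so the accumulator has to
    stay in \<open>U\<close>.\<close>
  then have "coprod X Y \<in> U"
    using structured_set_class.coprod_closed[OF assms(1)] by simp
  then show ?case
    using Cons assms(2) by (simp add: additive_def)
qed simp

theorem theorem2:
  fixes U :: "('a, 't) structured_set set"
    and coprod :: "('a, 't) structured_set \<Rightarrow> ('a, 't) structured_set \<Rightarrow> ('a, 't) structured_set"
    and F :: "('a, 't) structured_set_function"
    and k :: nat
  assumes "structured_set_class U coprod"
    and "additive U coprod F"
    and "has_regulars U F"
  shows "finitely_representable coprod F (bounded_subclass U F k)"
proof -
  let ?R = "regularity_sequence F" and ?V = "bounded_subclass U F k"
  obtain A where AU: "\<And>i. A i \<in> U" and A: "\<And>i. {j. ?R (A i) j > 0} = {i}"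
    using assms(3) unfolding has_regulars_def by metis
  define d where "d i = ?R (A i) i" for i
  have d: "d i > 0" for i unfolding d_def using A[of i] by blast
  have RA: "?R (A i) j = (if i = j then d i else 0)" for i j
    unfolding d_def using A[of i] by (cases "i = j") auto
  obtain B where B: "finite B" "B \<subseteq> ?V"
    and dom: "\<And>Y. Y \<in> ?V \<Longrightarrow>
      \<exists>X\<in>B. \<forall>i\<in>{..k}. ?R X i \<le> ?R Y i \<and> ?R X i mod d i = ?R Y i mod d i"
    using Dickson_mod[of "{..k}" d ?V ?R] d by auto
  define Z where "Z = B \<union> A ` {..k}"
  have "finite Z" unfolding Z_def using B by simp
  moreover have ZV: "Z \<subseteq> ?V"
    unfolding Z_def using B AU by (auto simp: bounded_subclass_def RA)
  moreover have "\<exists>Xs. Xs \<noteq> [] \<and> set Xs \<subseteq> Z \<and> ?R Y = ?R (iterated_coproduct coprod Xs)"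
    if Y: "Y \<in> ?V" for Y
  proof -
    obtain X where X: "X \<in> B"
      and le: "\<And>i. i \<le> k \<Longrightarrow> ?R X i \<le> ?R Y i"
      and cong: "\<And>i. i \<le> k \<Longrightarrow> ?R X i mod d i = ?R Y i mod d i"
      using dom[OF Y] by auto
    \<comment> \<open>The number of copies of \<open>A i\<close> that fill the gap at
      \<open>i\<close>; the division is exact for \<open>i \<le> k\<close> by the
      congruence.\<close>
    define m where "m i = (?R Y i - ?R X i) div d i" for i
    have m: "m i * d i = ?R Y i - ?R X i" if "i \<le> k" for i
      unfolding m_def using le[OF that] cong[OF that]
      by (metis dvd_div_mult_self mod_eq_dvd_iff_nat)
    define Xs where "Xs = concat (map (\<lambda>i. replicate (m i) (A i)) [0..<Suc k])"
    have Xs: "set Xs \<subseteq> A ` {..k}" unfolding Xs_def by (auto simp: less_Suc_eq_le)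
    have XU: "X \<in> ?V" "X \<in> U" using X B by (auto simp: bounded_subclass_def)
    have "?R Y j = ?R (foldl coprod X Xs) j" for j
    proof -
      \<comment> \<open>Stated for every upper end \<open>n\<close> so that induction
        applies.\<close>
      have "(\<Sum>W\<leftarrow>Xs. ?R W j) = (\<Sum>i\<leftarrow>[0..<n]. m i * ?R (A i) j)"
        if "Xs = concat (map (\<lambda>i. replicate (m i) (A i)) [0..<n])" for n Xs
        using that
        by (induction n arbitrary: Xs) (auto simp: sum_list_replicate)
      then have "(\<Sum>W\<leftarrow>Xs. ?R W j) = (\<Sum>i\<leftarrow>[0..<Suc k]. m i * ?R (A i) j)"
        unfolding Xs_def by blast
      also have "\<dots> = (\<Sum>i\<in>{..k}. if i = j then m i * d i else 0)"
        unfolding interv_sum_list_conv_sum_set_nat set_upt atLeast0LessThan lessThan_Suc_atMost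
        by (rule sum.cong) (auto simp: RA)
      also have "\<dots> = (if j \<le> k then m j * d j else 0)" by simp
      finally have "(\<Sum>W\<leftarrow>Xs. ?R W j) = (if j \<le> k then m j * d j else 0)" .
      moreover have "?R (foldl coprod X Xs) j = ?R X j + (\<Sum>W\<leftarrow>Xs. ?R W j)"
        using regularity_sequence_foldl[OF assms(1,2)] XU Xs AU by blast
      \<comment> \<open>Above \<open>k\<close> all contributions vanish; up to \<open>k\<close> the
        copies supply exactly the difference.\<close>
      moreover have "?R X j = 0" "?R Y j = 0" if "j > k"
        using XU Y that by (auto simp: bounded_subclass_def)
      ultimately show ?thesis using m[of j] le[of j] by (cases "j \<le> k") auto
    qed
    then show ?thesis
      using X Xs unfolding Z_def iterated_coproduct_def
      \<comment> \<open>Heading the list with \<open>X\<close> keeps it nonempty even when every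
        \<open>m i\<close> is zero.\<close>
      by (intro exI[of _ "X # Xs"]) auto
  qed
  ultimately show ?thesis unfolding finitely_representable_def by blast
qed

end
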